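(* Let $X$ be a separable Banach space that does not contain a (topologically isomorphic) copy of $c_0$. Assume that $\big(\{x_n\}_{n\in\mathbb{N}},\{x_n^*\}_{n\in\mathbb{N}}\big)\subseteq X\times X^*$ is a Schauder frame for $X$ and that $\{x_n\}_{n\in\mathbb{N}}$ does not contain infinitely many zeros. Then the following statements are equivalent. (a) $\{x_n\}_{n\in\mathbb{N}}$ is an unconditional basis for $X$ plus at most finitely many elements. (b) For every alternative dual $\{y_n^*\}_{n\in\mathbb{N}}$ of $\{x_n\}_{n\in\mathbb{N}}$ and every $x\in X$, $x=\sum_{n=1}^\infty\langle x,y_n^*\rangle x_n$ with unconditional convergence of the series in $X$.
   Context: For a Banach space $X$ with dual $X^*$, write $\langle x,x^*\rangle=x^*(x)$. A Schauder frame for $X$ is a pair of sequences $((x_n)_{n\in\mathbb{N}},(x_n^* )_{n\in\mathbb{N}})\subseteq X\times X^*$ such that $x=\sum_{n=1}^\infty\langle x,x_n^*\rangle x_n$ with norm convergence for every $x\in X$. A sequence $\{y_n^*\}_{n\in\mathbb{N}}\subseteq X^*$ is an alternative dual of $\{x_n\}_{n\in\mathbb{N}}$ if $x=\sum_{n=1}^\infty\langle x,y_n^*\rangle x_n$ (norm convergence) for all $x\in X$. A series converges unconditionally if it converges for every rearrangement. An unconditional basis is a Schauder basis for which the associated expansions converge unconditionally for every $x\in X$. "$\{x_n\}_{n\in\mathbb{N}}$ is an unconditional basis for $X$ plus at most finitely many elements" means there is a finite (possibly empty) $A\subseteq\mathbb{N}$ such that $\{x_n\}_{n\notin A}$ is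 an unconditional basis for $X$. *)

theory Defs
  imports "HOL-Analysis.Analysis"
begin

text \<open>
  Banach spaces over a scalar field that is either the reals or the complex numbers.  The
  real normed fields of finite dimension over the reals are, up to isometric isomorphism,
  exactly these two, so the type variable \<open>'k\<close> below ranges over both cases at once.  The type
  class \<open>banach\<close> only carries real scalars; multiplication by elements of \<open>'k\<close> is an additional
  operation extending \<open>scaleR\<close>.
\<close>

locale normed_space_over = vector_space smul
  for smul :: "'k::{real_normed_field,euclidean_space} \<Rightarrow> 'a::real_normed_vector \<Rightarrow> 'a" +
  assumes scale_of_real: "smul (of_real r) x = r *\<^sub>R x"
    and norm_scale: "norm (smul c x) = norm c * norm x"

lemma normed_space_over_real:
  "normed_space_over (scaleR :: real \<Rightarrow> 'a::real_normed_vector \<Rightarrow> 'a)"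
  by unfold_locales (auto simp: algebra_simps)

lemma normed_space_over_complex:
  "normed_space_over ((*) :: complex \<Rightarrow> complex \<Rightarrow> complex)"
  by unfold_locales (auto simp: algebra_simps norm_mult scaleR_conv_of_real)

definition dual_space ::
  "('k::{real_normed_field,euclidean_space} \<Rightarrow> 'a::real_normed_vector \<Rightarrow> 'a) \<Rightarrow> ('a \<Rightarrow> 'k) set"
  where "dual_space smul = {f. bounded_linear f \<and> (\<forall>c v. f (smul c v) = c * f v)}"

text \<open>Sequences are indexed from 0.\<close>

definition alternative_dual ::
  "('k::{real_normed_field,euclidean_space} \<Rightarrow> 'a::real_normed_vector \<Rightarrow> 'a) \<Rightarrow>
    (nat \<Rightarrow> 'a) \<Rightarrow> (nat \<Rightarrow> 'a \<Rightarrow> 'k) \<Rightarrow> bool"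
  where "alternative_dual smul x y \<longleftrightarrow>
    (\<forall>n. y n \<in> dual_space smul) \<and> (\<forall>v. (\<lambda>n. smul (y n v) (x n)) sums v)"

definition schauder_frame ::
  "('k::{real_normed_field,euclidean_space} \<Rightarrow> 'a::real_normed_vector \<Rightarrow> 'a) \<Rightarrow>
    (nat \<Rightarrow> 'a) \<Rightarrow> (nat \<Rightarrow> 'a \<Rightarrow> 'k) \<Rightarrow> bool"
  where "schauder_frame smul x f \<longleftrightarrow>
    (\<forall>n. f n \<in> dual_space smul) \<and> (\<forall>v. (\<lambda>n. smul (f n v) (x n)) sums v)"

definition unconditionally_convergent :: "(nat \<Rightarrow> 'a::real_normed_vector) \<Rightarrow> bool"
  where "unconditionally_convergent u \<longleftrightarrow> (\<forall>\<pi>. bij \<pi> \<longrightarrow> summable (\<lambda>n. u (\<pi> n)))"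

definition schauder_basis ::
  "('k::{real_normed_field,euclidean_space} \<Rightarrow> 'a::real_normed_vector \<Rightarrow> 'a) \<Rightarrow>
    (nat \<Rightarrow> 'a) \<Rightarrow> bool"
  where "schauder_basis smul e \<longleftrightarrow> (\<forall>v. \<exists>!c. (\<lambda>n. smul (c n) (e n)) sums v)"

definition unconditional_basis ::
  "('k::{real_normed_field,euclidean_space} \<Rightarrow> 'a::real_normed_vector \<Rightarrow> 'a) \<Rightarrow>
    (nat \<Rightarrow> 'a) \<Rightarrow> bool"
  where "unconditional_basis smul e \<longleftrightarrow> schauder_basis smul e \<and>
    (\<forall>v c. (\<lambda>n. smul (c n) (e n)) sums v \<longrightarrow>
      unconditionally_convergent (\<lambda>n. smul (c n) (e n)))"

text \<open>
  The type \<open>nat \<Rightarrow>\<^sub>C 'k\<close> is the space of bounded sequences with the supremum norm, since \<open>nat\<close>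
  carries the discrete topology.
\<close>

definition c0 :: "(nat \<Rightarrow>\<^sub>C 'k::real_normed_vector) set"
  where "c0 = {a. (\<lambda>n. apply_bcontfun a n) \<longlonglongrightarrow> 0}"

text \<open>
  A copy of \<open>c0\<close> is the image of a linear map on \<open>c0\<close> that is a homeomorphism onto its image.
  Linearity is over \<open>'k\<close>, but bounded continuous functions only come with multiplication by
  real scalars, so it is phrased through the entries of the sequences.
\<close>

definition contains_copy_of_c0 ::
  "('k::{real_normed_field,euclidean_space} \<Rightarrow> 'a::real_normed_vector \<Rightarrow> 'a) \<Rightarrow> bool"
  where "contains_copy_of_c0 smul \<longleftrightarrow>
    (\<exists>T S. (\<forall>a\<in>c0. \<forall>b\<in>c0. T (a + b) = T a + T b) \<and>
      (\<forall>k. \<forall>a\<in>c0. \<forall>b\<in>c0. (\<forall>n. apply_bcontfun b n = k * apply_bcontfun a n) \<longrightarrow>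
        T b = smul k (T a)) \<and>
      homeomorphism c0 (T ` c0) T S)"

end

theory Submission
  imports Defs
begin

text \<open>
The implication from the basis to the alternative duals holds because the terms of any expansion
of a vector outside the exceptional finite set form the basis expansion of some other vector.

For the converse, let (b) hold.  Perturbing the frame functionals by a rank one term shows that
every convergent series \<open>\<Sum>n. a n * x n\<close> converges unconditionally, whether or not its coefficients
come from an alternative dual (\<open>unconditionally_convergent_of_alternative_duals\<close>).  Consider the
coefficient sequences whose series converges to zero.  If there is a finite set of indices
at which every such sequence is determined by its entries, then deleting a minimal set of this kind
removes the redundancy exactly and leaves a basis (\<open>schauder_basis_of_finite_null_expansions\<close>), which is
unconditional.

Otherwise there are nonzero expansions of zero that start arbitrarily late.  Truncated and strung
together with coefficients from any null sequence, they still give a convergent series, since every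
one of them nearly cancels out.  Unconditional convergence allows keeping only a part of each of
them, chosen to have norm one.  The resulting vectors form a weakly unconditionally Cauchy sequence
that does not tend to zero (\<open>wuC_of_null_expansions\<close>).  By the argument of Bessaga and
Pelczynski, which the given frame makes elementary, such a sequence has a subsequence that spans
a copy of \<open>c0\<close> (\<open>wuC_imp_contains_copy_of_c0\<close>), contrary to the assumption on the space.
\<close>

section \<open>Cutting the natural numbers into blocks\<close>

lemma successive_choice:
  fixes R :: "nat \<Rightarrow> nat \<Rightarrow> nat \<Rightarrow> bool"
  assumes "\<And>k N. \<exists>M>N. R k N M"
  shows "\<exists>p. strict_mono p \<and> p 0 = 0 \<and> (\<forall>k. R k (p k) (p (Suc k)))"
proof -
  have "\<exists>p. \<forall>k. (k = 0 \<longrightarrow> p k = 0) \<and> (p k < p (Suc k) \<and> R k (p k) (p (Suc k)))"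
    by (rule dependent_nat_choice) (use assms in auto)
  then obtain p where p: "\<And>k. (k = 0 \<longrightarrow> p k = (0::nat)) \<and> p k < p (Suc k) \<and> R k (p k) (p (Suc k))"
    by blast
  show ?thesis
    by (rule exI[of _ p]) (use p in \<open>auto simp: strict_mono_Suc_iff\<close>)
qed

text \<open>
  For \<open>p\<close> strictly increasing with \<open>p 0 = 0\<close>, this is the number of the block
  \<open>{p k..<p (Suc k)}\<close> that contains \<open>n\<close>.
\<close>

definition block_index :: "(nat \<Rightarrow> nat) \<Rightarrow> nat \<Rightarrow> nat"
  where "block_index p n = (LEAST k. n < p (Suc k))"

lemma block_index_bounds:
  assumes "strict_mono p" "p 0 = 0"
  shows "p (block_index p n) \<le> n" "n < p (Suc (block_index p n))"
proof -
  have ex: "n < p (Suc n)"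
    using strict_mono_imp_increasing[OF assms(1), of "Suc n"] by simp
  show "n < p (Suc (block_index p n))"
    unfolding block_index_def by (rule LeastI[of _ n]) (rule ex)
  show "p (block_index p n) \<le> n"
  proof (cases "block_index p n")
    case 0
    then show ?thesis using assms by simp
  next
    case (Suc k)
    then have "\<not> n < p (Suc k)"
      unfolding block_index_def by (intro not_less_Least) simp
    then show ?thesis using Suc by simp
  qed
qed

lemma block_index_eq:
  assumes "strict_mono p" "p 0 = 0" "p k \<le> n" "n < p (Suc k)"
  shows "block_index p n = k"
proof -
  have "p (block_index p n) < p (Suc k)" "p k < p (Suc (block_index p n))"
    using block_index_bounds[OF assms(1,2), of n] assms(3,4) by linarith+
  then show ?thesis
    using assms(1) by (simp add: strict_mono_less)
qed

lemma block_index_ge: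
  assumes "strict_mono p" "p 0 = 0" "p k \<le> n"
  shows "k \<le> block_index p n"
proof -
  have "p k < p (Suc (block_index p n))"
    using block_index_bounds[OF assms(1,2), of n] assms(3) by linarith
  then show ?thesis
    using assms(1) by (simp add: strict_mono_less)
qed

lemma filterlim_block_index:
  assumes "strict_mono p" "p 0 = 0"
  shows "filterlim (block_index p) at_top sequentially"
  unfolding filterlim_at_top eventually_sequentially
  using block_index_ge[OF assms] by (meson order_trans)

section \<open>Unconditional convergence\<close>

lemma rearrange_to_front:
  fixes F :: "nat set"
  assumes "F \<subseteq> {p..<q}"
  shows "\<exists>g. bij_betw g {p..<q} {p..<q} \<and> g ` {p..<p + card F} = F"
proof -
  have fin: "finite F" using assms finite_subset by blast
  have le: "card F \<le> q - p" using card_mono[OF _ assms] by simp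
  obtain g where g: "bij_betw g {p..<p + card F} F"
    using finite_same_card_bij[of "{p..<p + card F}" F] fin by auto
  have "card {p + card F..<q} = card ({p..<q} - F)"
    using assms fin by (simp add: card_Diff_subset)
  then obtain h where h: "bij_betw h {p + card F..<q} ({p..<q} - F)"
    using finite_same_card_bij[of "{p + card F..<q}" "{p..<q} - F"] by auto
  define f where "f n = (if n < p + card F then g n else h n)" for n
  have 1: "bij_betw f {p..<p + card F} F"
    using g by (rule bij_betw_cong[THEN iffD1, rotated]) (auto simp: f_def)
  have 2: "bij_betw f {p + card F..<q} ({p..<q} - F)"
    using h by (rule bij_betw_cong[THEN iffD1, rotated]) (auto simp: f_def)
  have "bij_betw f ({p..<p + card F} \<union> {p + card F..<q}) (F \<union> ({p..<q} - F))"
    by (rule bij_betw_combine[OF 1 2]) auto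
  moreover have "{p..<p + card F} \<union> {p + card F..<q} = {p..<q}"
    using le assms fin by (cases "p \<le> q") auto
  moreover have "F \<union> ({p..<q} - F) = {p..<q}" using assms by auto
  ultimately show ?thesis
    using 1 by (auto simp: bij_betw_def intro!: exI[of _ f])
qed

lemma bij_blockwise:
  assumes p: "strict_mono p" "p 0 = 0"
    and g: "\<And>k. bij_betw (g k) {p k..<p (Suc k)} {p k..<p (Suc k)}"
  shows "bij (\<lambda>n. g (block_index p n) n)"
proof -
  let ?\<pi> = "\<lambda>n. g (block_index p n) n"
  have mem: "n \<in> {p (block_index p n)..<p (Suc (block_index p n))}" for n
    using block_index_bounds[OF p, of n] by simp
  have block: "block_index p (?\<pi> n) = block_index p n" for n
    using bij_betwE[OF g] mem[of n] by (intro block_index_eq[OF p]) auto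
  have "inj ?\<pi>"
  proof (rule injI)
    fix m n assume eq: "?\<pi> m = ?\<pi> n"
    then have k: "block_index p m = block_index p n"
      using block by metis
    show "m = n"
      using bij_betw_imp_inj_on[OF g[of "block_index p n"]] eq k mem[of m] mem[of n]
      by (auto dest: inj_onD)
  qed
  moreover have "\<exists>m. n = ?\<pi> m" for n
  proof -
    obtain m where m: "m \<in> {p (block_index p n)..<p (Suc (block_index p n))}"
      "n = g (block_index p n) m"
      using g[of "block_index p n"] mem[of n] by (metis bij_betw_def imageE)
    then have "block_index p m = block_index p n"
      by (intro block_index_eq[OF p]) auto
    with m show ?thesis by metis
  qed
  ultimately show ?thesis by (auto simp: bij_def surj_def)
qed

text \<open>
  If arbitrarily late finite sets \<open>F\<close> had sums of norm at least \<open>e\<close>, each such set could be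
  placed inside a block of its own.  Permuting every block so that its set \<open>F\<close> comes first
  gives a rearrangement with infinitely many consecutive stretches of norm at least \<open>e\<close>, which
  therefore diverges.
\<close>

lemma unconditionally_convergent_Cauchy:
  fixes u :: "nat \<Rightarrow> 'a::banach"
  assumes u: "unconditionally_convergent u" and "e > 0"
  shows "\<exists>N. \<forall>F. finite F \<and> F \<subseteq> {N..} \<longrightarrow> norm (sum u F) < e"
proof (rule ccontr)
  assume "\<not> ?thesis"
  then have bad: "\<exists>F. finite F \<and> F \<subseteq> {N..} \<and> norm (sum u F) \<ge> e" for N
    by (meson not_le)
  have "\<exists>M>N. \<exists>F\<subseteq>{N..<M}. norm (sum u F) \<ge> e" for N
  proof -
    obtain F where F: "finite F" "F \<subseteq> {N..}" "norm (sum u F) \<ge> e" using bad by blast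
    obtain M where "F \<subseteq> {..<M}" using finite_nat_bounded[OF F(1)] by blast
    then have "F \<subseteq> {N..<max M (Suc N)}" using F(2) by fastforce
    then show ?thesis using F(3) by (intro exI[of _ "max M (Suc N)"]) auto
  qed
  from successive_choice[of "\<lambda>_ N M. \<exists>F\<subseteq>{N..<M}. norm (sum u F) \<ge> e", OF this]
  obtain p where p: "strict_mono p" "p 0 = 0"
    and "\<And>k. \<exists>F\<subseteq>{p k..<p (Suc k)}. norm (sum u F) \<ge> e"
    by blast
  then obtain F where F: "\<And>k. F k \<subseteq> {p k..<p (Suc k)}" "\<And>k. norm (sum u (F k)) \<ge> e"
    by metis
  obtain g where g: "\<And>k. bij_betw (g k) {p k..<p (Suc k)} {p k..<p (Suc k)}"
    and gF: "\<And>k. g k ` {p k..<p k + card (F k)} = F k"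
    using rearrange_to_front[OF F(1)] by metis
  define \<pi> where "\<pi> n = g (block_index p n) n" for n
  have "bij \<pi>" unfolding \<pi>_def by (rule bij_blockwise[OF p g])
  then have "summable (\<lambda>n. u (\<pi> n))" using u by (simp add: unconditionally_convergent_def)
  then obtain N where N: "\<And>m n. m \<ge> N \<Longrightarrow> norm (\<Sum>i=m..<n. u (\<pi> i)) < e"
    using \<open>e > 0\<close> unfolding summable_Cauchy by blast
  have card: "p N + card (F N) \<le> p (Suc N)"
    using card_mono[OF _ F(1)[of N]] strict_monoD[OF p(1), of N "Suc N"] by simp
  have eq: "\<pi> i = g N i" if "i \<in> {p N..<p N + card (F N)}" for i
    using block_index_eq[OF p, of N i] that card by (simp add: \<pi>_def)
  have "inj_on (g N) {p N..<p N + card (F N)}"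
    using bij_betw_imp_inj_on[OF g[of N]] by (rule inj_on_subset) (use card in auto)
  then have "sum u (F N) = (\<Sum>i=p N..<p N + card (F N). u (g N i))"
    by (subst gF[of N, symmetric]) (simp add: sum.reindex o_def)
  also have "\<dots> = (\<Sum>i=p N..<p N + card (F N). u (\<pi> i))"
    by (rule sum.cong) (simp_all add: eq)
  finally have "norm (sum u (F N)) < e"
    using N[of "p N"] strict_mono_imp_increasing[OF p(1), of N] by simp
  with F(2)[of N] show False by simp
qed

text \<open>
  Convergence along the net of finite sets does not depend on an ordering of the indices, which makes
  it the convenient form of unconditional convergence: passing to a cofinite subfamily, and adding or
  removing finitely many terms, becomes a matter of library facts about \<open>summable_on\<close>.
\<close>

lemma unconditionally_convergent_iff_summable_on:
  fixes u :: "nat \<Rightarrow> 'a::banach"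
  shows "unconditionally_convergent u \<longleftrightarrow> u summable_on UNIV"
proof
  assume u: "unconditionally_convergent u"
  have "\<exists>P. eventually P (finite_subsets_at_top UNIV) \<and>
      (\<forall>F G. P F \<and> P G \<longrightarrow> dist (sum u F) (sum u G) < e)" if "e > 0" for e
  proof -
    obtain N where N: "\<And>F. finite F \<Longrightarrow> F \<subseteq> {N..} \<Longrightarrow> norm (sum u F) < e / 2"
      using unconditionally_convergent_Cauchy[OF u, of "e / 2"] \<open>e > 0\<close> by auto
    define P where "P F \<longleftrightarrow> finite F \<and> {..<N} \<subseteq> F" for F
    have "eventually P (finite_subsets_at_top UNIV)"
      unfolding eventually_finite_subsets_at_top P_def by (intro exI[of _ "{..<N}"]) auto
    moreover have "dist (sum u F) (sum u G) < e" if "P F" "P G" for F G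
    proof -
      have split: "sum u H = sum u {..<N} + sum u (H - {..<N})" if "P H" for H
        using that by (simp add: P_def sum_diff)
      have small: "norm (sum u (H - {..<N})) < e / 2" if "P H" for H
        using that by (intro N) (auto simp: P_def)
      have "dist (sum u F) (sum u G) = norm (sum u (F - {..<N}) - sum u (G - {..<N}))"
        using split[OF \<open>P F\<close>] split[OF \<open>P G\<close>] by (simp add: dist_norm)
      also have "\<dots> < e"
        using small[OF \<open>P F\<close>] small[OF \<open>P G\<close>]
          norm_triangle_ineq4[of "sum u (F - {..<N})" "sum u (G - {..<N})"] by linarith
      finally show ?thesis .
    qed
    ultimately show ?thesis by blast
  qed
  then have "cauchy_filter (filtermap (sum u) (finite_subsets_at_top UNIV))"
    by (simp add: cauchy_filter_metric_filtermap)
  moreover have "complete (UNIV :: 'a set)"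
    by (meson Cauchy_convergent UNIV_I complete_def convergent_def)
  ultimately obtain L where "(sum u \<longlongrightarrow> L) (finite_subsets_at_top UNIV)"
    using complete_uniform[where S=UNIV] by (force simp add: filterlim_def)
  then show "u summable_on UNIV"
    using summable_on_def has_sum_def by blast
next
  assume u: "u summable_on UNIV"
  show "unconditionally_convergent u"
    unfolding unconditionally_convergent_def
  proof (intro allI impI)
    fix \<pi> :: "nat \<Rightarrow> nat" assume "bij \<pi>"
    then have "(\<lambda>n. u (\<pi> n)) summable_on UNIV"
      using u summable_on_reindex_bij_betw by blast
    then show "summable (\<lambda>n. u (\<pi> n))" by (rule summable_on_imp_summable)
  qed
qed

lemma bij_betw_enumerate_cofinite:
  fixes A :: "nat set"
  assumes "finite A"
  shows "bij_betw (enumerate (- A)) UNIV (- A)"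
  using assms by (intro bij_enumerate) simp

lemma unconditionally_convergent_cofinite:
  fixes u :: "nat \<Rightarrow> 'a::banach"
  assumes "finite A"
  shows "unconditionally_convergent (\<lambda>n. u (enumerate (- A) n)) \<longleftrightarrow> unconditionally_convergent u"
proof -
  have "(\<lambda>n. u (enumerate (- A) n)) summable_on UNIV \<longleftrightarrow> u summable_on - A"
    by (rule summable_on_reindex_bij_betw[OF bij_betw_enumerate_cofinite[OF assms]])
  also have "\<dots> \<longleftrightarrow> u summable_on UNIV"
    using summable_on_Un_disjoint[of u "- A" A] assms
    by (auto intro: summable_on_subset_banach simp: Un_commute)
  finally show ?thesis by (simp add: unconditionally_convergent_iff_summable_on)
qed

lemma sums_enumerate_cofinite:
  fixes u :: "nat \<Rightarrow> 'a::real_normed_vector"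
  assumes "finite A" "\<And>n. n \<in> A \<Longrightarrow> u n = 0"
  shows "(\<lambda>n. u (enumerate (- A) n)) sums s \<longleftrightarrow> u sums s"
proof (rule sums_mono_reindex)
  have "infinite (- A)" using assms(1) by simp
  then show "strict_mono (enumerate (- A))" by (simp add: strict_mono_def)
  fix n assume "n \<notin> range (enumerate (- A))"
  then show "u n = 0"
    using bij_betw_imp_surj_on[OF bij_betw_enumerate_cofinite[OF assms(1)]] assms(2) by auto
qed

section \<open>The uniform boundedness principle\<close>

text \<open>
  The closed sets on which all the operators are bounded by a given \<open>n\<close> cover the space, so by Baire one
  of them contains a ball; differences of points of that ball bound the operators.
\<close>

lemma uniform_boundedness:
  fixes T :: "'i \<Rightarrow> 'a::banach \<Rightarrow> 'b::real_normed_vector"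
  assumes lin: "\<And>i. bounded_linear (T i)" and bdd: "\<And>x. \<exists>B. \<forall>i. norm (T i x) \<le> B"
  obtains K where "K > 0" "\<And>i x. norm (T i x) \<le> K * norm x"
proof -
  define U where "U n = {x. \<forall>i. norm (T i x) \<le> real n}" for n
  have closed: "closed (U n)" for n
    unfolding U_def
    by (intro closed_Collect_all closed_Collect_le continuous_intros
        linear_continuous_on[OF lin])
  have cover: "\<Union>(range U) = UNIV"
  proof -
    have "\<exists>n. x \<in> U n" for x
    proof -
      obtain B where "\<And>i. norm (T i x) \<le> B" using bdd by blast
      then show ?thesis
        using real_nat_ceiling_ge[of B] unfolding U_def by (intro exI[of _ "nat \<lceil>B\<rceil>"]) (auto intro: order_trans)
    qed
    then show ?thesis by blast
  qed
  have "\<exists>n. interior (U n) \<noteq> {}"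
  proof (rule ccontr)
    assume "\<not> ?thesis"
    then have "interior (\<Union>(range U)) = {}"
      using Met_TC.metric_Baire_category_alt[where 'a = 'a, of "range U"] closed
      by (auto simp: complete_UNIV)
    then show False using cover by simp
  qed
  then obtain n a e where "e > 0" and ball: "cball a e \<subseteq> U n"
    by (metis all_not_in_conv mem_interior_cball)
  have "norm (T i x) \<le> (2 * real n / e) * norm x" for i x
  proof (cases "x = 0")
    case True
    then show ?thesis using linear_0[OF bounded_linear.linear[OF lin]] by simp
  next
    case False
    define r where "r = e / norm x"
    have "r > 0" using False \<open>e > 0\<close> by (simp add: r_def)
    have "a + r *\<^sub>R x \<in> cball a e" "a \<in> cball a e"
      using False \<open>e > 0\<close> by (auto simp: r_def dist_norm)
    then have "norm (T i (a + r *\<^sub>R x)) \<le> n" "norm (T i a) \<le> n"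
      using ball unfolding U_def by blast+
    then have "norm (T i (a + r *\<^sub>R x) - T i a) \<le> 2 * n"
      using norm_triangle_ineq4[of "T i (a + r *\<^sub>R x)" "T i a"] by linarith
    moreover have "T i (a + r *\<^sub>R x) - T i a = r *\<^sub>R T i x"
      using lin[of i] by (simp add: bounded_linear.linear linear_add linear_scale)
    ultimately have "r * norm (T i x) \<le> 2 * n" using \<open>r > 0\<close> by simp
    then show ?thesis
      using False \<open>e > 0\<close> by (simp add: r_def field_simps)
  qed
  then have "norm (T i x) \<le> (2 * real n / e + 1) * norm x" for i x
    by (rule order_trans) (simp add: distrib_right)
  then show thesis
    using that[of "2 * real n / e + 1"] \<open>e > 0\<close> by (simp add: add_nonneg_pos)
qed

section \<open>Weakly unconditionally Cauchy sequences and copies of the space of null sequences\<close>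

locale banach_space_over = normed_space_over smul
  for smul :: "'k::{real_normed_field,euclidean_space} \<Rightarrow> 'a::banach \<Rightarrow> 'a"
begin

lemma bounded_bilinear_smul: "bounded_bilinear smul"
proof
  show "smul (r *\<^sub>R a) b = r *\<^sub>R smul a b" for r a b
    by (metis scale_of_real scale_scale scaleR_conv_of_real)
  show "smul a (r *\<^sub>R b) = r *\<^sub>R smul a b" for r a b
    by (metis scale_of_real scale_left_commute)
  show "\<exists>K. \<forall>a b. norm (smul a b) \<le> norm a * norm b * K"
    by (rule exI[of _ 1]) (simp add: norm_scale)
qed (simp_all add: scale_left_distrib scale_right_distrib)

lemmas bounded_linear_smul_left = bounded_bilinear.bounded_linear_left[OF bounded_bilinear_smul]
lemmas bounded_linear_smul_right = bounded_bilinear.bounded_linear_right[OF bounded_bilinear_smul]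

text \<open>
  Such a \<open>C\<close> exists exactly when the series of \<open>u\<close> is weakly unconditionally Cauchy.  It
  bounds the operator that sends the unit vectors of \<open>c0\<close> to the terms of \<open>u\<close>.
\<close>

definition wuC_bound :: "(nat \<Rightarrow> 'a) \<Rightarrow> real \<Rightarrow> bool"
  where "wuC_bound u C \<longleftrightarrow> (\<forall>F t. finite F \<longrightarrow> (\<forall>k\<in>F. norm (t k) \<le> 1) \<longrightarrow>
    norm (\<Sum>k\<in>F. smul (t k) (u k)) \<le> C)"

lemma wuC_bound_nonneg: "wuC_bound u C \<Longrightarrow> C \<ge> 0"
  unfolding wuC_bound_def by (metis finite.emptyI sum.empty norm_zero empty_iff)

lemma wuC_bound_scaled:
  assumes u: "wuC_bound u C" and F: "finite F" and t: "\<And>k. k \<in> F \<Longrightarrow> norm (t k) \<le> B"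
    and "B \<ge> 0"
  shows "norm (\<Sum>k\<in>F. smul (t k) (u k)) \<le> C * B"
proof (cases "B = 0")
  case True
  then have "(\<Sum>k\<in>F. smul (t k) (u k)) = 0" using t by (intro sum.neutral) auto
  then show ?thesis using True by simp
next
  case False
  have eq: "smul (t k) (u k) = smul (of_real B) (smul (t k / of_real B) (u k))" for k
    using False by simp
  have "norm (\<Sum>k\<in>F. smul (t k / of_real B) (u k)) \<le> C"
    using u F t False \<open>B \<ge> 0\<close> unfolding wuC_bound_def by (simp add: norm_divide)
  then have "B * norm (\<Sum>k\<in>F. smul (t k / of_real B) (u k)) \<le> B * C"
    using \<open>B \<ge> 0\<close> by (rule mult_left_mono)
  moreover have "norm (\<Sum>k\<in>F. smul (t k) (u k)) = B * norm (\<Sum>k\<in>F. smul (t k / of_real B) (u k))"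
    using \<open>B \<ge> 0\<close> by (subst eq) (simp only: scale_sum_right[symmetric] norm_scale norm_of_real abs_of_nonneg)
  ultimately show ?thesis by (simp add: mult.commute)
qed

lemma wuC_bound_subsequence:
  assumes u: "wuC_bound u C" and k: "inj k"
  shows "wuC_bound (\<lambda>i. u (k i)) C"
  unfolding wuC_bound_def
proof (intro allI impI)
  fix F :: "nat set" and t :: "nat \<Rightarrow> 'k"
  assume F: "finite F" and t: "\<forall>i\<in>F. norm (t i) \<le> 1"
  have "(\<Sum>l\<in>k ` F. smul (t (inv k l)) (u l)) = (\<Sum>i\<in>F. smul (t i) (u (k i)))"
    using k by (subst sum.reindex) (auto intro: inj_on_subset)
  moreover have "norm (\<Sum>l\<in>k ` F. smul (t (inv k l)) (u l)) \<le> C"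
    using u F t k unfolding wuC_bound_def by (auto simp: inv_f_f)
  ultimately show "norm (\<Sum>i\<in>F. smul (t i) (u (k i))) \<le> C" by simp
qed

text \<open>
  Choosing scalars of modulus at most one that turn every \<open>f (u k)\<close> into its absolute value
  bounds the sum of these absolute values by \<open>C\<close> times a bound of \<open>f\<close>.
\<close>

lemma wuC_bound_functional_null:
  assumes u: "wuC_bound u C" and f: "f \<in> dual_space smul"
  shows "(\<lambda>k. f (u k)) \<longlonglongrightarrow> 0"
proof -
  have bl: "bounded_linear f" and fs: "\<And>c v. f (smul c v) = c * f v"
    using f by (auto simp: dual_space_def)
  obtain L where L: "\<And>v. norm (f v) \<le> norm v * L" "L \<ge> 0"
    using bounded_linear.nonneg_bounded[OF bl] by blast
  have "(\<Sum>k<n. norm (f (u k))) \<le> C * L" for n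
  proof -
    define t where "t k = (if f (u k) = 0 then 0 else of_real (norm (f (u k))) / f (u k))" for k
    have t: "norm (t k) \<le> 1" "t k * f (u k) = of_real (norm (f (u k)))" for k
      by (auto simp: t_def norm_divide)
    have "f (\<Sum>k<n. smul (t k) (u k)) = of_real (\<Sum>k<n. norm (f (u k)))"
      using bl by (simp add: linear_sum bounded_linear.linear fs t)
    then have "(\<Sum>k<n. norm (f (u k))) = norm (f (\<Sum>k<n. smul (t k) (u k)))"
      by (simp add: sum_nonneg del: of_real_sum)
    also have "\<dots> \<le> norm (\<Sum>k<n. smul (t k) (u k)) * L" by (rule L)
    also have "\<dots> \<le> C * L"
      using u t(1) L(2) unfolding wuC_bound_def by (intro mult_right_mono) auto
    finally show ?thesis .
  qed
  then have "summable (\<lambda>k. norm (f (u k)))"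
    by (intro bounded_imp_summable[of _ "C * L"])
      (auto simp: lessThan_Suc_atMost[symmetric] simp del: sum.lessThan_Suc)
  then show ?thesis
    using summable_LIMSEQ_zero tendsto_norm_zero_iff by blast
qed

text \<open>
  Without a common bound there are finite sums with coefficients of modulus at most one, supported
  on disjoint blocks, whose norms exceed \<open>j + 1\<close> in the \<open>j\<close>-th block.  Dividing the
  coefficients there by \<open>j + 1\<close> gives a null sequence \<open>t\<close> whose sums over late blocks do not
  become small.
\<close>

lemma wuC_bound_of_null_multipliers:
  assumes u: "\<And>t e. t \<longlonglongrightarrow> 0 \<Longrightarrow> e > 0 \<Longrightarrow>
    \<exists>N. \<forall>F. finite F \<and> F \<subseteq> {N..} \<longrightarrow> norm (\<Sum>k\<in>F. smul (t k) (u k)) < e"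
  shows "\<exists>C. wuC_bound u C"
proof (rule ccontr)
  assume unbdd: "\<not> ?thesis"
  define R where "R j N M \<longleftrightarrow> (\<exists>F t. F \<subseteq> {N..<M} \<and> (\<forall>k\<in>F. norm (t k) \<le> 1) \<and>
    norm (\<Sum>k\<in>F. smul (t k) (u k)) > real (Suc j))" for j N M
  have "\<exists>M>N. R j N M" for j N
  proof -
    obtain F t where F: "finite F" "\<And>k. k \<in> F \<Longrightarrow> norm (t k) \<le> 1"
      and big: "norm (\<Sum>k\<in>F. smul (t k) (u k)) > real (Suc j) + (\<Sum>k<N. norm (u k))"
      using unbdd unfolding wuC_bound_def by (meson not_le)
    have "norm (\<Sum>k\<in>F \<inter> {..<N}. smul (t k) (u k)) \<le> (\<Sum>k\<in>F \<inter> {..<N}. norm (u k))"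
      using F(2) by (intro sum_norm_le) (auto simp: norm_scale mult_left_le_one_le)
    also have "\<dots> \<le> (\<Sum>k<N. norm (u k))"
      by (intro sum_mono2) auto
    finally have head: "norm (\<Sum>k\<in>F \<inter> {..<N}. smul (t k) (u k)) \<le> (\<Sum>k<N. norm (u k))" .
    have "(\<Sum>k\<in>F. smul (t k) (u k)) =
        (\<Sum>k\<in>F \<inter> {..<N}. smul (t k) (u k)) + (\<Sum>k\<in>F - {..<N}. smul (t k) (u k))"
      by (rule sum.Int_Diff[OF F(1)])
    then have tail: "norm (\<Sum>k\<in>F - {..<N}. smul (t k) (u k)) > real (Suc j)"
      using big head norm_triangle_ineq[of "\<Sum>k\<in>F \<inter> {..<N}. smul (t k) (u k)"
          "\<Sum>k\<in>F - {..<N}. smul (t k) (u k)"] by simp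
    obtain M where "F \<subseteq> {..<M}" using finite_nat_bounded[OF F(1)] by blast
    then have "F - {..<N} \<subseteq> {N..<max M (Suc N)}" by fastforce
    then have "R j N (max M (Suc N))"
      using F(2) tail unfolding R_def by (intro exI[of _ "F - {..<N}"] exI[of _ t]) auto
    then show ?thesis by (intro exI[of _ "max M (Suc N)"]) auto
  qed
  from successive_choice[of R, OF this]
  obtain p where p: "strict_mono p" "p 0 = 0" and R: "\<And>j. R j (p j) (p (Suc j))" by blast
  have "\<forall>j. \<exists>F t. F \<subseteq> {p j..<p (Suc j)} \<and> (\<forall>k\<in>F. norm (t k) \<le> 1) \<and>
      norm (\<Sum>k\<in>F. smul (t k) (u k)) > real (Suc j)"
    using R unfolding R_def by blast
  from choice[OF this] obtain F where "\<forall>j. \<exists>t. F j \<subseteq> {p j..<p (Suc j)} \<and>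
      (\<forall>k\<in>F j. norm (t k) \<le> 1) \<and> norm (\<Sum>k\<in>F j. smul (t k) (u k)) > real (Suc j)"
    by blast
  from choice[OF this] obtain T where F: "\<And>j. F j \<subseteq> {p j..<p (Suc j)}"
    and T: "\<And>j k. k \<in> F j \<Longrightarrow> norm (T j k) \<le> 1"
    and big: "\<And>j. norm (\<Sum>k\<in>F j. smul (T j k) (u k)) > real (Suc j)"
    by blast
  \<comment> \<open>The zero outside the sets \<open>F j\<close> makes \<open>t\<close> a null sequence without changing the sums over them.\<close>
  define t where "t k = (let j = block_index p k in
    if k \<in> F j then of_real (inverse (real (Suc j))) * T j k else 0)" for k
  have t_bound: "norm (t k) \<le> inverse (real (Suc (block_index p k)))" for k
    using T[of k "block_index p k"]
    by (auto simp: t_def Let_def norm_mult simp del: of_nat_Suc of_real_inverse intro!: mult_right_le_one_le)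
  have "(\<lambda>k. inverse (real (Suc (block_index p k)))) \<longlonglongrightarrow> 0"
    by (rule filterlim_compose[OF LIMSEQ_inverse_real_of_nat filterlim_block_index[OF p]])
  then have "t \<longlonglongrightarrow> 0"
    by (rule Lim_null_comparison[rotated]) (use t_bound in auto)
  then obtain N where N: "\<And>G. finite G \<Longrightarrow> G \<subseteq> {N..} \<Longrightarrow> norm (\<Sum>k\<in>G. smul (t k) (u k)) < 1"
    using u[of t 1] by auto
  have "F N \<subseteq> {N..}"
    using F[of N] strict_mono_imp_increasing[OF p(1), of N] by fastforce
  moreover have "finite (F N)" using F[of N] finite_subset by blast
  ultimately have small: "norm (\<Sum>k\<in>F N. smul (t k) (u k)) < 1" by (intro N)
  have "t k = of_real (inverse (real (Suc N))) * T N k" if "k \<in> F N" for k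
  proof -
    have "block_index p k = N"
      using F[of N] that by (intro block_index_eq[OF p]) auto
    then show ?thesis using that by (simp add: t_def)
  qed
  then have "(\<Sum>k\<in>F N. smul (t k) (u k)) =
      smul (of_real (inverse (real (Suc N)))) (\<Sum>k\<in>F N. smul (T N k) (u k))"
    unfolding scale_sum_right by (intro sum.cong refl) (simp add: scale_scale)
  then have "norm (\<Sum>k\<in>F N. smul (t k) (u k)) =
      inverse (real (Suc N)) * norm (\<Sum>k\<in>F N. smul (T N k) (u k))"
    by (simp only: norm_scale norm_of_real abs_inverse abs_of_nat)
  with small big[of N] show False by (simp add: field_simps)
qed

text \<open>
  Both estimates pass from finite sums to the operator \<open>T a = (\<Sum>k. a k * u k)\<close> on \<open>c0\<close>, which is
  thus bounded above and below.
\<close>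

lemma contains_copy_of_c0I:
  assumes u: "wuC_bound u C" and "c > 0"
    and lower: "\<And>n t j. j < n \<Longrightarrow> c * norm (t j) \<le> norm (\<Sum>k<n. smul (t k) (u k))"
  shows "contains_copy_of_c0 smul"
proof -
  have C: "C \<ge> 0" using u by (rule wuC_bound_nonneg)
  define g :: "(nat \<Rightarrow>\<^sub>C 'k) \<Rightarrow> nat \<Rightarrow> 'a" where "g a k = smul (apply_bcontfun a k) (u k)" for a k
  define T where "T a = suminf (g a)" for a
  have sm: "g a sums T a" if "a \<in> c0" for a
  proof -
    have "summable (g a)"
      unfolding summable_Cauchy
    proof (intro allI impI)
      fix e :: real assume "e > 0"
      define d where "d = e / (C + 1)"
      have "d > 0" "C * d < e" using \<open>e > 0\<close> C by (auto simp: d_def field_simps)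
      have "\<forall>\<^sub>F k in sequentially. norm (apply_bcontfun a k) < d"
        using that \<open>d > 0\<close> unfolding c0_def by (auto dest: tendstoD)
      then obtain N where N: "\<And>k. k \<ge> N \<Longrightarrow> norm (apply_bcontfun a k) < d"
        unfolding eventually_sequentially by blast
      have "norm (sum (g a) {m..<n}) < e" if "m \<ge> N" for m n
      proof -
        have "norm (sum (g a) {m..<n}) \<le> C * d"
          unfolding g_def using that \<open>d > 0\<close>
          by (intro wuC_bound_scaled[OF u]) (auto intro: less_imp_le[OF N])
        with \<open>C * d < e\<close> show ?thesis by simp
      qed
      then show "\<exists>N. \<forall>m\<ge>N. \<forall>n. norm (sum (g a) {m..<n}) < e" by blast
    qed
    then show ?thesis unfolding T_def by (rule summable_sums)
  qed
  have lim: "(\<lambda>n. norm (\<Sum>k<n. g a k)) \<longlonglongrightarrow> norm (T a)" if "a \<in> c0" for a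
    using sm[OF that] unfolding sums_def by (rule tendsto_norm)
  have ub: "norm (T a) \<le> C * norm a" if "a \<in> c0" for a
    using lim[OF that]
    by (rule LIMSEQ_le_const2) (auto simp: g_def intro!: wuC_bound_scaled[OF u] norm_bounded)
  have lb: "c * norm a \<le> norm (T a)" if "a \<in> c0" for a
  proof -
    have "c * norm (apply_bcontfun a j) \<le> norm (T a)" for j
      using lim[OF that]
      by (rule LIMSEQ_le_const) (auto simp: g_def intro!: exI[of _ "Suc j"] lower)
    then have "norm a \<le> norm (T a) / c"
      using \<open>c > 0\<close> by (intro norm_bound) (simp add: field_simps)
    then show ?thesis using \<open>c > 0\<close> by (simp add: field_simps)
  qed
  have add: "T (a + b) = T a + T b" if "a \<in> c0" "b \<in> c0" for a b
  proof -
    have "g (a + b) = (\<lambda>k. g a k + g b k)"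
      by (simp add: g_def fun_eq_iff scale_left_distrib)
    then have "g (a + b) sums (T a + T b)"
      using sums_add[OF sm[OF that(1)] sm[OF that(2)]] by simp
    then show ?thesis unfolding T_def by (rule sums_unique[symmetric])
  qed
  have scale: "T b = smul k (T a)"
    if "a \<in> c0" "b \<in> c0" "\<forall>n. apply_bcontfun b n = k * apply_bcontfun a n" for a b k
  proof -
    have "g b = (\<lambda>n. smul k (g a n))"
      using that(3) by (simp add: g_def fun_eq_iff)
    then have "g b sums smul k (T a)"
      using bounded_linear.sums[OF bounded_linear_smul_right sm[OF that(1)]] by simp
    then show ?thesis unfolding T_def by (rule sums_unique[symmetric])
  qed
  have diff_c0: "a - b \<in> c0" if "a \<in> c0" "b \<in> c0" for a b :: "nat \<Rightarrow>\<^sub>C 'k"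
    using that tendsto_diff[of "apply_bcontfun a" 0 sequentially "apply_bcontfun b" 0]
    by (simp add: c0_def)
  have diff: "T a - T b = T (a - b)" if "a \<in> c0" "b \<in> c0" for a b
    using add[OF diff_c0[OF that] that(2)] by (simp add: algebra_simps)
  have "C-lipschitz_on c0 T"
    using ub diff diff_c0 C by (intro lipschitz_onI) (auto simp: dist_norm)
  then have contT: "continuous_on c0 T" by (rule lipschitz_on_continuous_on)
  have lbd: "dist a b \<le> 1 / c * dist (T a) (T b)" if "a \<in> c0" "b \<in> c0" for a b
    using lb[OF diff_c0[OF that]] diff[OF that] \<open>c > 0\<close> by (simp add: dist_norm field_simps)
  have inj: "inj_on T c0"
  proof (rule inj_onI)
    fix a b assume "a \<in> c0" "b \<in> c0" "T a = T b"
    then show "a = b" using lbd[of a b] by simp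
  qed
  have "(1 / c)-lipschitz_on (T ` c0) (inv_into c0 T)"
    using lbd \<open>c > 0\<close> by (intro lipschitz_onI) (auto simp: inv_into_f_f[OF inj])
  then have contS: "continuous_on (T ` c0) (inv_into c0 T)" by (rule lipschitz_on_continuous_on)
  have "homeomorphism c0 (T ` c0) T (inv_into c0 T)"
    using contT contS inj by (auto simp: homeomorphism_def inv_into_f_f image_image f_inv_into_f)
  then show ?thesis
    unfolding contains_copy_of_c0_def using add scale by blast
qed

section \<open>Gliding humps along a Schauder frame\<close>

definition partial_sum_operator :: "(nat \<Rightarrow> 'a) \<Rightarrow> (nat \<Rightarrow> 'a \<Rightarrow> 'k) \<Rightarrow> nat \<Rightarrow> 'a \<Rightarrow> 'a"
  where "partial_sum_operator x f m w = (\<Sum>n<m. smul (f n w) (x n))"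

lemma bounded_linear_partial_sum_operator:
  assumes "schauder_frame smul x f"
  shows "bounded_linear (partial_sum_operator x f m)"
proof -
  have "bounded_linear (f n)" for n
    using assms by (simp add: schauder_frame_def dual_space_def)
  then show ?thesis
    unfolding partial_sum_operator_def
    by (intro bounded_linear_sum bounded_linear_compose[OF bounded_linear_smul_left])
qed

lemma partial_sum_operator_smul:
  assumes "schauder_frame smul x f"
  shows "partial_sum_operator x f m (smul c w) = smul c (partial_sum_operator x f m w)"
  using assms
  by (simp add: partial_sum_operator_def schauder_frame_def dual_space_def scale_sum_right)

lemma partial_sum_operator_tendsto:
  assumes "schauder_frame smul x f"
  shows "(\<lambda>m. partial_sum_operator x f m w) \<longlonglongrightarrow> w"
  using assms by (simp add: partial_sum_operator_def schauder_frame_def sums_def)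

lemma partial_sum_operator_bounded:
  assumes "schauder_frame smul x f"
  obtains K where "K > 0" "\<And>m w. norm (partial_sum_operator x f m w) \<le> K * norm w"
proof (rule uniform_boundedness[of "partial_sum_operator x f"])
  show "\<exists>B. \<forall>m. norm (partial_sum_operator x f m w) \<le> B" for w
    using convergent_imp_Bseq[OF convergentI[OF partial_sum_operator_tendsto[OF assms]], of w]
    unfolding Bseq_def by blast
qed (use that bounded_linear_partial_sum_operator[OF assms] in blast)+

lemma partial_sum_operator_null:
  assumes x: "schauder_frame smul x f" and u: "wuC_bound u C"
  shows "(\<lambda>k. partial_sum_operator x f m (u k)) \<longlonglongrightarrow> 0"
  unfolding partial_sum_operator_def
proof (rule tendsto_null_sum)
  fix n
  have "(\<lambda>k. f n (u k)) \<longlonglongrightarrow> 0"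
    using x by (intro wuC_bound_functional_null[OF u]) (simp add: schauder_frame_def)
  from bounded_linear.tendsto[OF bounded_linear_smul_left this]
  show "(\<lambda>k. smul (f n (u k)) (x n)) \<longlonglongrightarrow> 0" by simp
qed

text \<open>
  The vectors of a weakly unconditionally Cauchy sequence vanish in the limit on every fixed
  initial piece of the frame expansion, while the expansion of a single vector is exhausted by a
  long enough initial piece.  Choosing alternately a late vector and a long piece makes the
  chosen vectors live, up to \<open>\<eta>\<close>, on consecutive disjoint pieces of the expansion.
\<close>

lemma almost_block_subsequence:
  assumes x: "schauder_frame smul x f" and u: "wuC_bound u C" and \<eta>: "\<And>i::nat. \<eta> i > 0"
  obtains p k where "strict_mono p" "inj k"
    "\<And>i m. m \<le> p i \<Longrightarrow> norm (partial_sum_operator x f m (u (k i))) \<le> \<eta> i"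
    "\<And>i m. m \<ge> p (Suc i) \<Longrightarrow> norm (partial_sum_operator x f m (u (k i)) - u (k i)) \<le> \<eta> i"
proof -
  let ?S = "partial_sum_operator x f"
  \<comment> \<open>Taking \<open>k\<close> between \<open>p\<close> and \<open>q\<close> makes the chosen indices increase with \<open>i\<close>.\<close>
  define R where "R i p q \<longleftrightarrow> (\<exists>k. p \<le> k \<and> k < q \<and> (\<forall>m\<le>p. norm (?S m (u k)) \<le> \<eta> i) \<and>
    (\<forall>m\<ge>q. norm (?S m (u k) - u k) \<le> \<eta> i))" for i p q
  have "\<exists>q>p. R i p q" for i p
  proof -
    have "\<forall>\<^sub>F k in sequentially. norm (?S m (u k)) \<le> \<eta> i" for m
      using tendstoD[OF partial_sum_operator_null[OF x u] \<eta>, of m i]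
      by (rule eventually_mono) simp
    then have "\<forall>\<^sub>F k in sequentially. \<forall>m\<in>{..p}. norm (?S m (u k)) \<le> \<eta> i"
      by (intro eventually_ball_finite) auto
    then obtain k where k: "k \<ge> p" "\<And>m. m \<le> p \<Longrightarrow> norm (?S m (u k)) \<le> \<eta> i"
      unfolding eventually_sequentially by (metis atMost_iff nle_le)
    have "\<forall>\<^sub>F m in sequentially. norm (?S m (u k) - u k) \<le> \<eta> i"
      using tendstoD[OF partial_sum_operator_tendsto[OF x] \<eta>, of "u k" i]
      by (rule eventually_mono) (simp add: dist_norm)
    then obtain q where "\<And>m. m \<ge> q \<Longrightarrow> norm (?S m (u k) - u k) \<le> \<eta> i"
      unfolding eventually_sequentially by blast
    then have "R i p (max q (Suc k))"
      using k unfolding R_def by (intro exI[of _ k]) auto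
    then show ?thesis using k(1) by (intro exI[of _ "max q (Suc k)"]) auto
  qed
  from successive_choice[of R, OF this]
  obtain p where p: "strict_mono p" "\<And>i. R i (p i) (p (Suc i))" by blast
  have "\<forall>i. \<exists>k. p i \<le> k \<and> k < p (Suc i) \<and> (\<forall>m\<le>p i. norm (?S m (u k)) \<le> \<eta> i) \<and>
      (\<forall>m\<ge>p (Suc i). norm (?S m (u k) - u k) \<le> \<eta> i)"
    using p(2) unfolding R_def by blast
  from choice[OF this] obtain k where k: "\<And>i. p i \<le> k i" "\<And>i. k i < p (Suc i)"
    "\<And>i m. m \<le> p i \<Longrightarrow> norm (?S m (u (k i))) \<le> \<eta> i"
    "\<And>i m. m \<ge> p (Suc i) \<Longrightarrow> norm (?S m (u (k i)) - u (k i)) \<le> \<eta> i"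
    by blast
  have "strict_mono k"
    unfolding strict_mono_Suc_iff using k(1,2) less_le_trans by blast
  then have "inj k" by (rule strict_mono_imp_inj_on)
  then show thesis by (rule that[OF p(1) _ k(3,4)])
qed

text \<open>
  This is the Bessaga-Pelczynski theorem for spaces with a Schauder frame.  The difference \<open>P j\<close>
  of two partial sum operators nearly fixes the \<open>j\<close>-th vector of an almost disjoint
  subsequence and nearly annihilates the others, so applying it to a linear combination recovers
  the \<open>j\<close>-th coefficient.  Since the operators \<open>P j\<close> are uniformly bounded, the norm of a
  linear combination dominates its largest coefficient.  The frame replaces both the passage to a
  basic sequence and the Hahn-Banach theorem of the classical proof.
\<close>

theorem wuC_imp_contains_copy_of_c0:
  assumes x: "schauder_frame smul x f" and u: "wuC_bound u C"
    and "\<delta> > 0" and \<delta>: "\<And>k. norm (u k) \<ge> \<delta>"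
  shows "contains_copy_of_c0 smul"
proof -
  let ?S = "partial_sum_operator x f"
  \<comment> \<open>The errors \<open>2 * \<eta> i\<close> must add up to at most half of the lower bound \<open>\<delta>\<close>.\<close>
  define \<eta> where "\<eta> i = \<delta> / 8 * (1/2) ^ i" for i :: nat
  have \<eta>_pos: "\<eta> i > 0" for i using \<open>\<delta> > 0\<close> by (simp add: \<eta>_def)
  have \<eta>_sum: "(\<Sum>i<n. \<eta> i) \<le> \<delta> / 4" for n
  proof -
    have "(\<Sum>i<n. (1/2::real) ^ i) \<le> 2"
      using sum_le_suminf[of "\<lambda>i. (1/2::real) ^ i" "{..<n}"] by (simp add: suminf_geometric)
    then show ?thesis
      using \<open>\<delta> > 0\<close> unfolding \<eta>_def sum_distrib_left[symmetric] by simp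
  qed
  obtain p k where p: "strict_mono p" and k: "inj k"
    and before: "\<And>i m. m \<le> p i \<Longrightarrow> norm (?S m (u (k i))) \<le> \<eta> i"
    and after: "\<And>i m. m \<ge> p (Suc i) \<Longrightarrow> norm (?S m (u (k i)) - u (k i)) \<le> \<eta> i"
    using almost_block_subsequence[OF x u, of \<eta>] \<eta>_pos by blast
  define v where "v i = u (k i)" for i
  obtain K where "K > 0" and K: "\<And>m w. norm (?S m w) \<le> K * norm w"
    using partial_sum_operator_bounded[OF x] by blast
  define P where "P j w = ?S (p (Suc j)) w - ?S (p j) w" for j w
  have P_linear: "bounded_linear (P j)" for j
    unfolding P_def by (intro bounded_linear_sub bounded_linear_partial_sum_operator x)
  have P_smul: "P j (smul c w) = smul c (P j w)" for j c w
    by (simp add: P_def partial_sum_operator_smul[OF x] scale_right_diff_distrib)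
  have P_diag: "norm (P j (v i) - (if i = j then v i else 0)) \<le> 2 * \<eta> i" for i j
  proof -
    consider "i < j" | "i = j" | "j < i" by linarith
    then show ?thesis
    proof cases
      case 1
      then have "p (Suc i) \<le> p j" "p (Suc i) \<le> p (Suc j)"
        using p by (auto simp: strict_mono_less_eq)
      from after[OF this(1)] after[OF this(2)] 1 show ?thesis
        using norm_triangle_ineq4[of "?S (p (Suc j)) (v i) - v i" "?S (p j) (v i) - v i"]
        by (simp add: P_def v_def)
    next
      case 2
      then show ?thesis
        using norm_triangle_ineq4[of "?S (p (Suc i)) (v i) - v i" "?S (p i) (v i)"]
          before[of "p i" i] after[of i "p (Suc i)"]
        by (simp add: P_def v_def algebra_simps)
    next
      case 3
      then have "p j \<le> p i" "p (Suc j) \<le> p i"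
        using p by (auto simp: strict_mono_less_eq)
      from before[OF this(1)] before[OF this(2)] 3 show ?thesis
        using norm_triangle_ineq4[of "?S (p (Suc j)) (v i)" "?S (p j) (v i)"]
        by (simp add: P_def v_def)
    qed
  qed
  have "\<delta> / (4 * K) * norm (t i) \<le> norm (\<Sum>l<n. smul (t l) (v l))" if "i < n" for i n t
  proof -
    \<comment> \<open>The largest coefficient also controls the errors caused by the others.\<close>
    have "Max ((\<lambda>l. norm (t l)) ` {..<n}) \<in> (\<lambda>l. norm (t l)) ` {..<n}"
      using that by (intro Max_in) auto
    then obtain j where j: "j < n" "norm (t j) = Max ((\<lambda>l. norm (t l)) ` {..<n})"
      by auto
    then have max: "norm (t l) \<le> norm (t j)" if "l < n" for l
      using that by simp
    let ?w = "\<Sum>l<n. smul (t l) (v l)"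
    have "P j ?w = (\<Sum>l<n. smul (t l) (P j (v l)))"
      using P_linear by (simp add: linear_sum bounded_linear.linear P_smul)
    moreover have "smul (t j) (v j) = (\<Sum>l<n. smul (t l) (if l = j then v l else 0))"
      using j(1) by (simp add: if_distrib[of "smul _"] cong: if_cong)
    ultimately have "P j ?w - smul (t j) (v j) =
        (\<Sum>l<n. smul (t l) (P j (v l) - (if l = j then v l else 0)))"
      by (simp add: sum_subtractf[symmetric] scale_right_diff_distrib)
    also have "norm \<dots> \<le> (\<Sum>l<n. norm (t j) * (2 * \<eta> l))"
      using P_diag max by (intro sum_norm_le) (simp only: norm_scale lessThan_iff mult_mono norm_ge_zero)
    also have "\<dots> = norm (t j) * (2 * (\<Sum>l<n. \<eta> l))"
      by (simp add: sum_distrib_left)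
    also have "\<dots> \<le> norm (t j) * (\<delta> / 2)"
      using \<eta>_sum[of n] by (intro mult_left_mono) auto
    finally have 1: "norm (P j ?w - smul (t j) (v j)) \<le> norm (t j) * (\<delta> / 2)" .
    have 2: "norm (smul (t j) (v j)) \<ge> norm (t j) * \<delta>"
      using \<delta> by (simp add: norm_scale v_def mult_left_mono)
    have 3: "norm (P j ?w) \<le> 2 * K * norm ?w"
      using norm_triangle_ineq4[of "?S (p (Suc j)) ?w" "?S (p j) ?w"]
        K[of "p (Suc j)" ?w] K[of "p j" ?w] by (simp add: P_def)
    have "norm (smul (t j) (v j)) \<le> norm (P j ?w) + norm (P j ?w - smul (t j) (v j))"
      using norm_triangle_sub[of "smul (t j) (v j)" "P j ?w"] by (simp add: norm_minus_commute)
    with 1 2 3 have "norm (t j) * \<delta> / 2 \<le> 2 * K * norm ?w" by simp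
    then have "\<delta> / (4 * K) * norm (t j) \<le> norm ?w"
      using \<open>K > 0\<close> by (simp add: field_simps)
    moreover have "\<delta> / (4 * K) * norm (t i) \<le> \<delta> / (4 * K) * norm (t j)"
      using max[OF that] \<open>\<delta> > 0\<close> \<open>K > 0\<close> by (intro mult_left_mono) auto
    ultimately show ?thesis by simp
  qed
  then show ?thesis
    using \<open>\<delta> > 0\<close> \<open>K > 0\<close> unfolding v_def
    by (intro contains_copy_of_c0I[OF wuC_bound_subsequence[OF u k], of "\<delta> / (4 * K)"]) auto
qed

section \<open>Nontrivial expansions of zero\<close>

definition null_expansions :: "(nat \<Rightarrow> 'a) \<Rightarrow> (nat \<Rightarrow> 'k) set"
  where "null_expansions x = {z. (\<lambda>n. smul (z n) (x n)) sums 0}"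

lemma maximal_term:
  fixes s :: "nat \<Rightarrow> 'b::real_normed_vector"
  assumes "s \<longlonglongrightarrow> 0"
  shows "\<exists>m. \<forall>l. norm (s l) \<le> norm (s m)"
proof (cases "\<forall>l. s l = 0")
  case False
  then obtain l0 where "s l0 \<noteq> 0" by blast
  then obtain L where L: "\<And>l. l \<ge> L \<Longrightarrow> norm (s l) < norm (s l0)"
    using tendstoD[OF assms, of "norm (s l0)"] by (auto simp: eventually_sequentially)
  have "Max ((\<lambda>l. norm (s l)) ` {..max L l0}) \<in> (\<lambda>l. norm (s l)) ` {..max L l0}"
    by (intro Max_in) auto
  then obtain m where m: "norm (s m) = Max ((\<lambda>l. norm (s l)) ` {..max L l0})"
    by (metis imageE)
  have le: "norm (s l) \<le> norm (s m)" if "l \<le> max L l0" for l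
    unfolding m using that by (intro Max_ge) auto
  have "norm (s l) \<le> norm (s m)" for l
    using le[of l] le[of l0] L[of l] by (cases "l \<le> max L l0") force+
  then show ?thesis by blast
qed auto

text \<open>
  An expansion of zero that starts late is truncated once its partial sums have become small,
  after being normalised so that its largest partial sum has norm one.  The largest partial sum
  is not zero because a nonzero coefficient beyond all zeros of \<open>x\<close> changes the partial sum.
\<close>

lemma null_block:
  assumes zeros: "finite {n. x n = 0}"
    and inf: "\<And>N. \<exists>z\<in>null_expansions x. (\<forall>n<N. z n = 0) \<and> z \<noteq> (\<lambda>_. 0)"
    and "e > 0"
  shows "\<exists>M>N. \<exists>z m. N \<le> m \<and> m \<le> M \<and>
    norm (\<Sum>n=N..<m. smul (z n) (x n)) = 1 \<and>
    (\<forall>l. norm (\<Sum>n=N..<l. smul (z n) (x n)) \<le> 1) \<and>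
    norm (\<Sum>n=N..<M. smul (z n) (x n)) \<le> e"
proof -
  obtain N0 where N0: "\<And>n. x n = 0 \<Longrightarrow> n < N0"
    using finite_nat_bounded[OF zeros] by blast
  obtain z where z: "z \<in> null_expansions x" "\<And>n. n < max N N0 \<Longrightarrow> z n = 0" "z \<noteq> (\<lambda>_. 0)"
    using inf[of "max N N0"] by blast
  define s where "s l = (\<Sum>n=N..<l. smul (z n) (x n))" for l
  have s_eq: "s l = (\<Sum>n<l. smul (z n) (x n))" for l
    unfolding s_def using z(2) by (intro sum.mono_neutral_left) auto
  have s0: "s \<longlonglongrightarrow> 0"
    using z(1) unfolding s_eq[abs_def] null_expansions_def sums_def by simp
  obtain m where m: "\<And>l. norm (s l) \<le> norm (s m)" using maximal_term[OF s0] by blast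
  obtain n where "z n \<noteq> 0" using z(3) by auto
  then have "x n \<noteq> 0" using z(2)[of n] N0[of n] by fastforce
  have "s (Suc n) - s n \<noteq> 0"
    using \<open>z n \<noteq> 0\<close> \<open>x n \<noteq> 0\<close> by (simp add: s_eq)
  then have "s m \<noteq> 0" using m[of n] m[of "Suc n"] by auto
  then have "N \<le> m" by (cases "N \<le> m") (auto simp: s_def)
  define r where "r = inverse (norm (s m))"
  have "r > 0" using \<open>s m \<noteq> 0\<close> by (simp add: r_def)
  have scaled: "norm (\<Sum>n=N..<l. smul (of_real r * z n) (x n)) = r * norm (s l)" for l
  proof -
    have "(\<Sum>n=N..<l. smul (of_real r * z n) (x n)) = smul (of_real r) (s l)"
      unfolding s_def scale_sum_right by simp
    then show ?thesis using \<open>r > 0\<close> by (simp add: norm_scale)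
  qed
  obtain L where L: "\<And>l. l \<ge> L \<Longrightarrow> norm (s l) < e / r"
    using tendstoD[OF s0, of "e / r"] \<open>e > 0\<close> \<open>r > 0\<close> by (auto simp: eventually_sequentially)
  define M where "M = max L (Suc m)"
  have "r * norm (s M) \<le> e"
    using L[of M] \<open>r > 0\<close> by (simp add: M_def field_simps)
  moreover have "r * norm (s l) \<le> 1" for l
    using m[of l] \<open>s m \<noteq> 0\<close> by (simp add: r_def field_simps)
  moreover have "r * norm (s m) = 1"
    using \<open>s m \<noteq> 0\<close> by (simp add: r_def)
  ultimately show ?thesis
    using \<open>N \<le> m\<close>
    by (intro exI[of _ M] conjI exI[of _ "\<lambda>n. of_real r * z n"] exI[of _ m])
      (simp_all only: scaled, auto simp: M_def)
qed

text \<open>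
  Truncated expansions of zero \<open>z k\<close> are placed on consecutive blocks.  For every null sequence
  \<open>t\<close> the series with coefficients \<open>t k * z k n\<close> converges: the complete blocks are summable, and
  inside a block the partial sums are bounded by the modulus of \<open>t k\<close>.  By hypothesis it converges
  unconditionally, so it remains Cauchy when in each block only the initial piece is kept on
  which the partial sum has norm one.  Those pieces are the vectors \<open>u k\<close>: the cancellation
  inside a block is destroyed, and \<open>u\<close> is weakly unconditionally Cauchy without tending to zero.
\<close>

lemma wuC_of_null_expansions:
  assumes unc: "\<And>a s. (\<lambda>n. smul (a n) (x n)) sums s \<Longrightarrow>
      unconditionally_convergent (\<lambda>n. smul (a n) (x n))"
    and zeros: "finite {n. x n = 0}"
    and inf: "\<And>N. \<exists>z\<in>null_expansions x. (\<forall>n<N. z n = 0) \<and> z \<noteq> (\<lambda>_. 0)"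
  shows "\<exists>u C. wuC_bound u C \<and> (\<forall>k. norm (u k) = 1)"
proof -
  define R where "R k N M \<longleftrightarrow> (\<exists>z m. N \<le> m \<and> m \<le> M \<and>
    norm (\<Sum>n=N..<m. smul (z n) (x n)) = 1 \<and>
    (\<forall>l. norm (\<Sum>n=N..<l. smul (z n) (x n)) \<le> 1) \<and>
    norm (\<Sum>n=N..<M. smul (z n) (x n)) \<le> (1/2) ^ k)" for k N M
  have "\<exists>M>N. R k N M" for k N
    unfolding R_def by (rule null_block[OF zeros inf]) simp
  from successive_choice[of R, OF this]
  obtain p where p: "strict_mono p" "p 0 = 0" and R: "\<And>k. R k (p k) (p (Suc k))" by blast
  from R have "\<forall>k. \<exists>z m. p k \<le> m \<and> m \<le> p (Suc k) \<and>
    norm (\<Sum>n=p k..<m. smul (z n) (x n)) = 1 \<and>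
    (\<forall>l. norm (\<Sum>n=p k..<l. smul (z n) (x n)) \<le> 1) \<and>
    norm (\<Sum>n=p k..<p (Suc k). smul (z n) (x n)) \<le> (1/2) ^ k"
    unfolding R_def by blast
  from choice[OF this] obtain z where "\<forall>k. \<exists>m. p k \<le> m \<and> m \<le> p (Suc k) \<and>
    norm (\<Sum>n=p k..<m. smul (z k n) (x n)) = 1 \<and>
    (\<forall>l. norm (\<Sum>n=p k..<l. smul (z k n) (x n)) \<le> 1) \<and>
    norm (\<Sum>n=p k..<p (Suc k). smul (z k n) (x n)) \<le> (1/2) ^ k"
    by blast
  from choice[OF this] obtain m where m: "\<And>k. p k \<le> m k" "\<And>k. m k \<le> p (Suc k)"
    and norm1: "\<And>k. norm (\<Sum>n=p k..<m k. smul (z k n) (x n)) = 1"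
    and le1: "\<And>k l. norm (\<Sum>n=p k..<l. smul (z k n) (x n)) \<le> 1"
    and small: "\<And>k. norm (\<Sum>n=p k..<p (Suc k). smul (z k n) (x n)) \<le> (1/2) ^ k"
    by blast
  define s where "s k l = (\<Sum>n=p k..<l. smul (z k n) (x n))" for k l
  define u where "u k = s k (m k)" for k
  have "\<exists>C. wuC_bound u C"
  proof (rule wuC_bound_of_null_multipliers)
    fix t :: "nat \<Rightarrow> 'k" and e :: real
    assume t: "t \<longlonglongrightarrow> 0" and "e > 0"
    define a where "a n = t (block_index p n) * z (block_index p n) n" for n
    have in_block: "(\<Sum>n\<in>I. smul (a n) (x n)) = smul (t k) (\<Sum>n\<in>I. smul (z k n) (x n))"
      if "I \<subseteq> {p k..<p (Suc k)}" for I k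
    proof -
      have "block_index p n = k" if "n \<in> I" for n
        using that \<open>I \<subseteq> _\<close> by (intro block_index_eq[OF p]) auto
      then show ?thesis
        unfolding scale_sum_right by (intro sum.cong refl) (simp add: a_def)
    qed
    have split: "(\<Sum>n<l. smul (a n) (x n)) = (\<Sum>n<p k. smul (a n) (x n)) + smul (t k) (s k l)"
      if "p k \<le> l" "l \<le> p (Suc k)" for k l
    proof -
      have "{..<l} = {..<p k} \<union> {p k..<l}" using that by auto
      then have "(\<Sum>n<l. smul (a n) (x n)) =
          (\<Sum>n<p k. smul (a n) (x n)) + (\<Sum>n=p k..<l. smul (a n) (x n))"
        by (simp add: sum.union_disjoint ivl_disj_int)
      then show ?thesis using that by (simp add: in_block[of _ k] s_def)
    qed
    have whole: "(\<Sum>n<p k. smul (a n) (x n)) = (\<Sum>i<k. smul (t i) (s i (p (Suc i))))" for k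
    proof (induction k)
      case (Suc k)
      have "p k \<le> p (Suc k)" using p(1) by (simp add: strict_mono_less_eq)
      then show ?case using split[of k "p (Suc k)"] Suc by simp
    qed (simp add: p)
    obtain B where B: "\<And>i. norm (t i) \<le> B"
      using convergent_imp_Bseq[OF convergentI[OF t]] unfolding Bseq_def by blast
    have "summable (\<lambda>i. smul (t i) (s i (p (Suc i))))"
    proof (rule summable_comparison_test')
      show "summable (\<lambda>i. B * (1/2) ^ i)" by (intro summable_mult summable_geometric) simp
      fix i :: nat
      show "norm (smul (t i) (s i (p (Suc i)))) \<le> B * (1/2) ^ i"
        using small[of i] B[of i] order_trans[OF norm_ge_zero B[of i]]
        unfolding norm_scale s_def by (intro mult_mono) auto
    qed
    then obtain L where "(\<lambda>k. \<Sum>i<k. smul (t i) (s i (p (Suc i)))) \<longlonglongrightarrow> L"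
      unfolding summable_def sums_def by blast
    from filterlim_compose[OF this filterlim_block_index[OF p]]
    have "(\<lambda>l. \<Sum>n<p (block_index p l). smul (a n) (x n)) \<longlonglongrightarrow> L"
      by (simp add: whole)
    moreover have "(\<lambda>l. smul (t (block_index p l)) (s (block_index p l) l)) \<longlonglongrightarrow> 0"
    proof (rule Lim_null_comparison)
      show "(\<lambda>l. norm (t (block_index p l))) \<longlonglongrightarrow> 0"
        using filterlim_compose[OF t filterlim_block_index[OF p]] by (rule tendsto_norm_zero)
      show "\<forall>\<^sub>F l in sequentially. norm (smul (t (block_index p l)) (s (block_index p l) l))
          \<le> norm (t (block_index p l))"
        using le1 by (simp add: norm_scale s_def mult_left_le)
    qed
    ultimately have "(\<lambda>l. (\<Sum>n<p (block_index p l). smul (a n) (x n)) +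
        smul (t (block_index p l)) (s (block_index p l) l)) \<longlonglongrightarrow> L + 0"
      by (rule tendsto_add)
    moreover have "(\<Sum>n<p (block_index p l). smul (a n) (x n)) +
        smul (t (block_index p l)) (s (block_index p l) l) = (\<Sum>n<l. smul (a n) (x n))" for l
      using block_index_bounds[OF p, of l] by (intro split[symmetric]) simp_all
    ultimately have "(\<lambda>l. \<Sum>n<l. smul (a n) (x n)) \<longlonglongrightarrow> L + 0" by simp
    then have "unconditionally_convergent (\<lambda>n. smul (a n) (x n))"
      by (intro unc) (simp add: sums_def)
    from unconditionally_convergent_Cauchy[OF this \<open>e > 0\<close>]
    obtain N where N: "\<And>G. finite G \<Longrightarrow> G \<subseteq> {N..} \<Longrightarrow> norm (\<Sum>n\<in>G. smul (a n) (x n)) < e"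
      by blast
    have "norm (\<Sum>k\<in>F. smul (t k) (u k)) < e" if F: "finite F" "F \<subseteq> {N..}" for F
    proof -
      have disj: "{p i..<m i} \<inter> {p j..<m j} = {}" if "i \<noteq> j" for i j
      proof -
        have "n \<in> {p k..<m k} \<Longrightarrow> block_index p n = k" for n k
          using m(2)[of k] by (intro block_index_eq[OF p]) auto
        then show ?thesis using that by blast
      qed
      have sub: "{p k..<m k} \<subseteq> {p k..<p (Suc k)}" for k using m(2)[of k] by auto
      have "(\<Sum>n\<in>(\<Union>k\<in>F. {p k..<m k}). smul (a n) (x n)) =
          (\<Sum>k\<in>F. \<Sum>n=p k..<m k. smul (a n) (x n))"
        using F(1) disj by (intro sum.UNION_disjoint) auto
      also have "\<dots> = (\<Sum>k\<in>F. smul (t k) (u k))"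
        by (simp add: in_block[OF sub] u_def s_def)
      finally have eq: "(\<Sum>n\<in>(\<Union>k\<in>F. {p k..<m k}). smul (a n) (x n)) = (\<Sum>k\<in>F. smul (t k) (u k))" .
      have "(\<Union>k\<in>F. {p k..<m k}) \<subseteq> {N..}"
      proof
        fix n assume "n \<in> (\<Union>k\<in>F. {p k..<m k})"
        then obtain k where "k \<in> F" "p k \<le> n" by auto
        then show "n \<in> {N..}"
          using F(2) strict_mono_imp_increasing[OF p(1), of k] by auto
      qed
      then show ?thesis
        unfolding eq[symmetric] using F(1) by (intro N) auto
    qed
    then show "\<exists>N. \<forall>F. finite F \<and> F \<subseteq> {N..} \<longrightarrow> norm (\<Sum>k\<in>F. smul (t k) (u k)) < e" by blast
  qed
  then obtain C where "wuC_bound u C" by blast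
  moreover have "norm (u k) = 1" for k using norm1 by (simp add: u_def s_def)
  ultimately show ?thesis by blast
qed

section \<open>Passing to a cofinite subfamily\<close>

lemma null_expansions_diff:
  assumes "(\<lambda>n. smul (a n) (x n)) sums s" "(\<lambda>n. smul (b n) (x n)) sums s"
  shows "(\<lambda>n. a n - b n) \<in> null_expansions x"
  using sums_diff[OF assms] by (simp add: null_expansions_def scale_left_diff_distrib)

lemma null_expansions_scale:
  assumes "z \<in> null_expansions x"
  shows "(\<lambda>n. c * z n) \<in> null_expansions x"
  using bounded_linear.sums[OF bounded_linear_smul_right, of _ 0 c] assms
  by (fastforce simp: null_expansions_def)

lemma extend_by_zero:
  assumes "finite A"
  obtains a :: "nat \<Rightarrow> 'k" where "\<And>n. n \<in> A \<Longrightarrow> a n = 0" "\<And>n. a (enumerate (- A) n) = c n"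
proof (rule that)
  note bij = bij_betw_enumerate_cofinite[OF assms]
  let ?a = "\<lambda>n. if n \<in> A then 0 else c (inv_into UNIV (enumerate (- A)) n)"
  show "?a (enumerate (- A) n) = c n" for n
    using bij_betwE[OF bij] bij_betw_inv_into_left[OF bij] by simp
qed simp

text \<open>
  The set \<open>A\<close> is a smallest set of coordinates that determines an expansion of zero.  By
  minimality each coordinate in \<open>A\<close> has an expansion of zero that is one there and zero on the
  rest of \<open>A\<close>.  Subtracting multiples of these from the frame expansion of a vector removes the
  coordinates in \<open>A\<close>, which gives existence; uniqueness is the choice of \<open>A\<close>.
\<close>

lemma schauder_basis_of_finite_null_expansions:
  assumes x: "schauder_frame smul x f"
    and N: "\<And>z. z \<in> null_expansions x \<Longrightarrow> (\<And>n. n < N \<Longrightarrow> z n = 0) \<Longrightarrow> z = (\<lambda>_. 0)"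
  obtains A where "finite A" "schauder_basis smul (\<lambda>n. x (enumerate (- A) n))"
proof -
  define P where "P A \<longleftrightarrow> finite A \<and>
    (\<forall>z\<in>null_expansions x. (\<forall>n\<in>A. z n = 0) \<longrightarrow> z = (\<lambda>_. 0))" for A
  have "P {..<N}" using N by (auto simp: P_def)
  then obtain A where A: "P A" and least: "\<And>B. P B \<Longrightarrow> card A \<le> card B"
    using ex_has_least_nat[of P "{..<N}" card] by blast
  have fin: "finite A" using A by (simp add: P_def)
  have sep: "z = (\<lambda>_. 0)" if "z \<in> null_expansions x" "\<And>n. n \<in> A \<Longrightarrow> z n = 0" for z
    using A that by (simp add: P_def)
  have "\<exists>z\<in>null_expansions x. z l = 1 \<and> (\<forall>n\<in>A - {l}. z n = 0)" if "l \<in> A" for l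
  proof -
    have "\<not> P (A - {l})"
      using least[of "A - {l}"] that fin card_Diff1_less[of A l] by auto
    then obtain z where z: "z \<in> null_expansions x" "\<forall>n\<in>A - {l}. z n = 0" "z \<noteq> (\<lambda>_. 0)"
      using fin unfolding P_def by auto
    have "z l \<noteq> 0" using sep[OF z(1)] z(2,3) by auto
    then show ?thesis
      using z(2) null_expansions_scale[OF z(1), of "inverse (z l)"]
      by (intro bexI[of _ "\<lambda>n. inverse (z l) * z n"]) auto
  qed
  then obtain d where d: "\<And>l. l \<in> A \<Longrightarrow> d l \<in> null_expansions x" "\<And>l. l \<in> A \<Longrightarrow> d l l = 1"
    "\<And>l n. l \<in> A \<Longrightarrow> n \<in> A \<Longrightarrow> n \<noteq> l \<Longrightarrow> d l n = 0"
    by (metis Diff_iff singletonD)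
  have "\<exists>!c. (\<lambda>n. smul (c n) (x (enumerate (- A) n))) sums v" for v
  proof -
    define a where "a n = f n v - (\<Sum>l\<in>A. f l v * d l n)" for n
    have a0: "a n = 0" if "n \<in> A" for n
    proof -
      have "(\<Sum>l\<in>A. f l v * d l n) = (\<Sum>l\<in>A. if l = n then f l v else 0)"
        using d(2,3) that by (intro sum.cong) auto
      then show ?thesis using that fin by (simp add: a_def)
    qed
    have "(\<lambda>n. \<Sum>l\<in>A. smul (f l v * d l n) (x n)) sums (\<Sum>l\<in>A. 0)"
      using null_expansions_scale[OF d(1)] by (intro sums_sum) (simp add: null_expansions_def)
    moreover have "(\<lambda>n. smul (f n v) (x n)) sums v"
      using x by (simp add: schauder_frame_def)
    ultimately have "(\<lambda>n. smul (a n) (x n)) sums (v - 0)"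
      unfolding a_def scale_left_diff_distrib scale_sum_left
      by (intro sums_diff) auto
    then have ex: "(\<lambda>n. smul (a (enumerate (- A) n)) (x (enumerate (- A) n))) sums v"
      using sums_enumerate_cofinite[OF fin, of "\<lambda>n. smul (a n) (x n)" v] a0 by simp
    moreover have "c = c'"
      if c: "(\<lambda>n. smul (c n) (x (enumerate (- A) n))) sums v"
        and c': "(\<lambda>n. smul (c' n) (x (enumerate (- A) n))) sums v" for c c'
    proof -
      obtain b where b: "\<And>n. n \<in> A \<Longrightarrow> b n = 0" "\<And>n. b (enumerate (- A) n) = c n"
        using extend_by_zero[OF fin] by blast
      obtain b' where b': "\<And>n. n \<in> A \<Longrightarrow> b' n = 0" "\<And>n. b' (enumerate (- A) n) = c' n"
        using extend_by_zero[OF fin] by blast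
      have "(\<lambda>n. smul (b n) (x n)) sums v" "(\<lambda>n. smul (b' n) (x n)) sums v"
        using sums_enumerate_cofinite[OF fin, of "\<lambda>n. smul (b n) (x n)" v]
          sums_enumerate_cofinite[OF fin, of "\<lambda>n. smul (b' n) (x n)" v] b b' c c' by simp_all
      then have "(\<lambda>n. b n - b' n) = (\<lambda>_. 0)"
        using b(1) b'(1) by (intro sep null_expansions_diff) auto
      then have "b = b'" by (simp add: fun_eq_iff)
      then show "c = c'" using b(2) b'(2) by (simp add: fun_eq_iff)
    qed
    ultimately show ?thesis by (intro ex1I) auto
  qed
  then show thesis using fin by (intro that) (simp add: schauder_basis_def)+
qed

text \<open>
  Removing the finitely many terms with index in \<open>A\<close> leaves the basis expansion of another vector.
\<close>

lemma unconditional_basis_imp_unconditionally_convergent: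
  assumes fin: "finite A" and basis: "unconditional_basis smul (\<lambda>n. x (enumerate (- A) n))"
    and a: "(\<lambda>n. smul (a n) (x n)) sums s"
  shows "unconditionally_convergent (\<lambda>n. smul (a n) (x n))"
proof -
  let ?u = "\<lambda>n. smul (a n) (x n)"
  define w where "w n = (if n \<in> A then 0 else ?u n)" for n
  have "(\<lambda>n. ?u n - (if n \<in> A then ?u n else 0)) sums (s - sum ?u A)"
    using fin by (intro sums_diff[OF a] sums_If_finite_set)
  moreover have "(\<lambda>n. ?u n - (if n \<in> A then ?u n else 0)) = w"
    by (simp add: w_def fun_eq_iff)
  ultimately have "(\<lambda>n. w (enumerate (- A) n)) sums (s - sum ?u A)"
    by (subst sums_enumerate_cofinite[OF fin]) (simp_all add: w_def)
  moreover have "w (enumerate (- A) n) = ?u (enumerate (- A) n)" for n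
    using bij_betwE[OF bij_betw_enumerate_cofinite[OF fin]] by (simp add: w_def)
  ultimately have "(\<lambda>n. ?u (enumerate (- A) n)) sums (s - sum ?u A)" by simp
  then have "unconditionally_convergent (\<lambda>n. ?u (enumerate (- A) n))"
    using basis by (auto simp: unconditional_basis_def)
  then show ?thesis
    using unconditionally_convergent_cofinite[OF fin, of ?u] by blast
qed

lemma unconditional_basis_of_unconditionally_convergent:
  assumes fin: "finite A" and basis: "schauder_basis smul (\<lambda>n. x (enumerate (- A) n))"
    and unc: "\<And>a s. (\<lambda>n. smul (a n) (x n)) sums s \<Longrightarrow>
      unconditionally_convergent (\<lambda>n. smul (a n) (x n))"
  shows "unconditional_basis smul (\<lambda>n. x (enumerate (- A) n))"
proof -
  have "unconditionally_convergent (\<lambda>n. smul (c n) (x (enumerate (- A) n)))"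
    if c: "(\<lambda>n. smul (c n) (x (enumerate (- A) n))) sums v" for c v
  proof -
    obtain a where a: "\<And>n. n \<in> A \<Longrightarrow> a n = 0" "\<And>n. a (enumerate (- A) n) = c n"
      using extend_by_zero[OF fin] by blast
    have "(\<lambda>n. smul (a n) (x n)) sums v"
      using sums_enumerate_cofinite[OF fin, of "\<lambda>n. smul (a n) (x n)" v] a c by simp
    then have "unconditionally_convergent (\<lambda>n. smul (a n) (x n))" by (rule unc)
    then have "unconditionally_convergent (\<lambda>n. smul (a (enumerate (- A) n)) (x (enumerate (- A) n)))"
      using unconditionally_convergent_cofinite[OF fin, of "\<lambda>n. smul (a n) (x n)"] by blast
    then show ?thesis by (simp add: a(2))
  qed
  then show ?thesis using basis by (auto simp: unconditional_basis_def)
qed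

lemma frame_functional_nonzero:
  assumes x: "schauder_frame smul x f" and "w \<noteq> 0"
  shows "\<exists>n. f n w \<noteq> 0"
proof (rule ccontr)
  assume "\<not> ?thesis"
  moreover have "(\<lambda>n. smul (f n w) (x n)) sums w" using x by (simp add: schauder_frame_def)
  ultimately have "(\<lambda>n. 0 :: 'a) sums w" by simp
  then show False using \<open>w \<noteq> 0\<close> sums_unique2[OF sums_zero] by blast
qed

section \<open>Alternative duals\<close>

text \<open>
  Both \<open>a\<close> and the frame coefficients of \<open>s\<close> expand \<open>s\<close>.  Their difference expands zero, so adding any functional times this difference to the frame functionals gives another
  alternative dual.  A functional \<open>\<phi>\<close> with value one at some vector makes \<open>a\<close> visible in that
  dual.  Since the frame functionals separate points, \<open>\<phi>\<close> can be a multiple of one of them.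
\<close>

lemma unconditionally_convergent_of_alternative_duals:
  assumes x: "schauder_frame smul x f" and "x k \<noteq> 0"
    and alt: "\<And>y v. alternative_dual smul x y \<Longrightarrow>
      unconditionally_convergent (\<lambda>n. smul (y n v) (x n))"
    and a: "(\<lambda>n. smul (a n) (x n)) sums s"
  shows "unconditionally_convergent (\<lambda>n. smul (a n) (x n))"
proof -
  have f: "bounded_linear (f n)" "f n (smul c v) = c * f n v"
    "(\<lambda>n. smul (f n v) (x n)) sums v" for n c v
    using x by (auto simp: schauder_frame_def dual_space_def)
  obtain l where l: "f l (x k) \<noteq> 0"
    using frame_functional_nonzero[OF x \<open>x k \<noteq> 0\<close>] by blast
  define \<phi> where "\<phi> v = f l v / f l (x k)" for v
  define y where "y n v = f n v + \<phi> v * (a n - f n s)" for n v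
  have "bounded_linear (y n)" for n
    unfolding y_def \<phi>_def
    by (intro bounded_linear_add f bounded_linear_mult_const bounded_linear_divide
        bounded_linear_compose[OF bounded_linear_divide])
  moreover have "y n (smul c v) = c * y n v" for n c v
    by (simp add: y_def \<phi>_def f algebra_simps)
  moreover have "(\<lambda>n. smul (y n v) (x n)) sums v" for v
  proof -
    have "(\<lambda>n. smul (f n v) (x n) + smul (\<phi> v) (smul (a n) (x n) - smul (f n s) (x n)))
        sums (v + smul (\<phi> v) (s - s))"
      by (intro sums_add bounded_linear.sums[OF bounded_linear_smul_right] sums_diff f a)
    then show ?thesis
      by (simp add: y_def scale_left_distrib scale_left_diff_distrib scale_right_diff_distrib right_diff_distrib)
  qed
  ultimately have y: "alternative_dual smul x y"
    by (simp add: alternative_dual_def dual_space_def)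
  have f_dual: "alternative_dual smul x f"
    using x by (simp add: alternative_dual_def schauder_frame_def)
  have "\<phi> (x k) = 1" using l by (simp add: \<phi>_def)
  then have "a n = y n (x k) - f n (x k) + f n s" for n by (simp add: y_def)
  then have eq: "(\<lambda>n. smul (a n) (x n)) =
      (\<lambda>n. smul (y n (x k)) (x n) + - smul (f n (x k)) (x n) + smul (f n s) (x n))"
    by (simp add: fun_eq_iff scale_left_distrib scale_left_diff_distrib)
  then show ?thesis
    using alt[OF y, of "x k"] alt[OF f_dual, of "x k"] alt[OF f_dual, of s]
    unfolding unconditionally_convergent_iff_summable_on eq
    by (intro summable_on_add) (simp_all add: summable_on_uminus)
qed

end

theorem theorem5p16:
  fixes smul :: "'k::{real_normed_field,euclidean_space} \<Rightarrow> 'a::banach \<Rightarrow> 'a"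
    and x :: "nat \<Rightarrow> 'a" and xs :: "nat \<Rightarrow> 'a \<Rightarrow> 'k"
  assumes "normed_space_over smul"
    and "separable_space (euclidean :: 'a topology)"
    and "\<not> contains_copy_of_c0 smul"
    and "schauder_frame smul x xs"
    and "finite {n. x n = 0}"
  shows "(\<exists>A. finite A \<and> unconditional_basis smul (\<lambda>n. x (enumerate (- A) n))) \<longleftrightarrow>
    (\<forall>y. alternative_dual smul x y \<longrightarrow>
      (\<forall>v. (\<lambda>n. smul (y n v) (x n)) sums v \<and>
        unconditionally_convergent (\<lambda>n. smul (y n v) (x n))))"
proof -
  interpret banach_space_over smul
    using assms(1) by (simp add: banach_space_over_def)
  show ?thesis
  proof (intro iffI allI impI conjI)
    fix y v
    assume "\<exists>A. finite A \<and> unconditional_basis smul (\<lambda>n. x (enumerate (- A) n))"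
      and y: "alternative_dual smul x y"
    then obtain A where "finite A" "unconditional_basis smul (\<lambda>n. x (enumerate (- A) n))" by blast
    moreover show "(\<lambda>n. smul (y n v) (x n)) sums v"
      using y by (simp add: alternative_dual_def)
    ultimately show "unconditionally_convergent (\<lambda>n. smul (y n v) (x n))"
      by (rule unconditional_basis_imp_unconditionally_convergent)
  next
    assume alt: "\<forall>y. alternative_dual smul x y \<longrightarrow>
      (\<forall>v. (\<lambda>n. smul (y n v) (x n)) sums v \<and>
        unconditionally_convergent (\<lambda>n. smul (y n v) (x n)))"
    have "{n. x n = 0} \<noteq> UNIV" using assms(5) by auto
    then obtain k where k: "x k \<noteq> 0" by auto
    have unc: "unconditionally_convergent (\<lambda>n. smul (a n) (x n))"
      if "(\<lambda>n. smul (a n) (x n)) sums s" for a s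
      by (rule unconditionally_convergent_of_alternative_duals[OF assms(4) k _ that])
        (use alt in blast)
    have "\<exists>N. \<forall>z\<in>null_expansions x. (\<forall>n<N. z n = 0) \<longrightarrow> z = (\<lambda>_. 0)"
    proof (rule ccontr)
      assume "\<not> ?thesis"
      then have inf: "\<exists>z\<in>null_expansions x. (\<forall>n<N. z n = 0) \<and> z \<noteq> (\<lambda>_. 0)" for N
        by blast
      have "\<exists>u C. wuC_bound u C \<and> (\<forall>k. norm (u k) = 1)"
        by (rule wuC_of_null_expansions[OF _ assms(5) inf]) (erule unc)
      then obtain u C where u: "wuC_bound u C" "\<And>k. norm (u k) = 1" by blast
      have "contains_copy_of_c0 smul"
        by (rule wuC_imp_contains_copy_of_c0[OF assms(4) u(1), of 1]) (simp_all add: u(2))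
      with assms(3) show False by contradiction
    qed
    then obtain N where N: "z = (\<lambda>_. 0)"
      if "z \<in> null_expansions x" "\<And>n. n < N \<Longrightarrow> z n = 0" for z
      by blast
    obtain A where A: "finite A" "schauder_basis smul (\<lambda>n. x (enumerate (- A) n))"
      by (rule schauder_basis_of_finite_null_expansions[OF assms(4) N])
    have "unconditional_basis smul (\<lambda>n. x (enumerate (- A) n))"
      by (rule unconditional_basis_of_unconditionally_convergent[OF A]) (erule unc)
    then show "\<exists>A. finite A \<and> unconditional_basis smul (\<lambda>n. x (enumerate (- A) n))"
      using A(1) by blast
  qed
qed

end
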